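(* For all integers $m,n\ge 1$, the graph $OTIS(BF(2m+1,2n+1))$ is Hamiltonian.
   Context: All graphs are finite, simple and undirected. For integers $p,q\ge 3$, the (generalized) butterfly/bowtie graph $BF(p,q)$ is the graph consisting of two cycles $C_p$ and $C_q$ (on $p$ and $q$ vertices) sharing exactly one vertex, which is a cutvertex. Explicitly, its vertex set is $\{1,2,\dots,p+q-1\}$; with $c=p$, the vertices $1,2,\dots,c$ form in this cyclic order the cycle $C_p$, and the vertices $c,c+1,\dots,p+q-1$ form in this cyclic order the cycle $C_q$; there are no other edges. For a graph $G$, the graph $OTIS(G)$ has vertex set $\{\langle u,v\rangle : u,v\in V(G)\}$ and edge set $$\{(\langle v,u\rangle,\langle v,u'\rangle) : v\in V(G),\ (u,u')\in E(G)\}\ \cup\ \{(\langle v,u\rangle,\langle u,v\rangle) : u,v\in V(G),\ u\ne v\}.$$ A graph is Hamiltonian if it has a cycle passing through every vertex exactly once. *)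

theory Defs
  imports "Graph_Theory.Graph_Theory"
begin

text \<open>
  A finite simple undirected graph is a \<^locale>\<open>pair_graph\<close>: each undirected edge is
  represented by its two orientations, as in Graph_Theory.
\<close>

definition cycle_edges :: "nat \<Rightarrow> nat \<Rightarrow> (nat \<times> nat) set" where
  "cycle_edges a b = (let E = {(i, i + 1) | i. a \<le> i \<and> i < b} \<union> {(b, a)} in E \<union> E\<inverse>)"

definition BF :: "nat \<Rightarrow> nat \<Rightarrow> nat pair_pre_digraph" where
  "BF p q = \<lparr> pverts = {1..p + q - 1}, parcs = cycle_edges 1 p \<union> cycle_edges p (p + q - 1) \<rparr>"

definition OTIS :: "'a pair_pre_digraph \<Rightarrow> ('a \<times> 'a) pair_pre_digraph" where
  "OTIS G = \<lparr> pverts = pverts G \<times> pverts G,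
     parcs = {((v, u), (v, u')) | v u u'. v \<in> pverts G \<and> (u, u') \<in> parcs G}
           \<union> {((v, u), (u, v)) | u v. u \<in> pverts G \<and> v \<in> pverts G \<and> u \<noteq> v} \<rparr>"

text \<open>
  In the symmetric digraph representation an edge traversed back and forth is a directed cycle of
  length 2; the bound on the length excludes it, since it is not a cycle of the undirected graph.
  Distinctness of the visited vertices is part of \<^const>\<open>pre_digraph.cycle\<close>.
\<close>

definition hamiltonian :: "'a pair_pre_digraph \<Rightarrow> bool" where
  "hamiltonian G \<longleftrightarrow>
     (\<exists>C. pre_digraph.cycle (with_proj G) C \<and> 3 \<le> length C \<and> fst ` set C = pverts G)"

lemma finite_cycle_edges: "finite (cycle_edges a b)"
proof -
  have "cycle_edges a b \<subseteq> ({..a + b} \<times> {..a + b})"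
    by (auto simp: cycle_edges_def Let_def)
  then show ?thesis by (rule finite_subset) simp
qed

lemma sym_cycle_edges: "sym (cycle_edges a b)"
  by (auto simp: cycle_edges_def Let_def sym_def)

lemma pair_graph_BF:
  assumes "3 \<le> p" "3 \<le> q"
  shows "pair_graph (BF p q)"
proof
  show "symmetric (with_proj (BF p q))"
    using sym_cycle_edges by (auto simp: symmetric_def BF_def intro: sym_Un)
qed (use assms finite_cycle_edges in \<open>auto simp: BF_def cycle_edges_def Let_def\<close>)

lemma pair_graph_OTIS:
  assumes "pair_graph G"
  shows "pair_graph (OTIS G)"
proof -
  interpret pair_graph G by fact
  have sub: "parcs (OTIS G) \<subseteq> (pverts G \<times> pverts G) \<times> (pverts G \<times> pverts G)"
    by (auto simp: OTIS_def dest: in_arcsD1 in_arcsD2)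
  show ?thesis
  proof
    show "finite (parcs (OTIS G))"
      by (rule finite_subset[OF sub]) (simp add: pair_finite_verts)
    show "symmetric (with_proj (OTIS G))"
      using pair_sym_arcs by (auto simp: symmetric_def OTIS_def sym_def)
    show "fst e \<noteq> snd e" if "e \<in> parcs (OTIS G)" for e
      using that pair_no_loops by (force simp: OTIS_def)
  qed (use sub in \<open>auto simp: OTIS_def pair_finite_verts dest: in_arcsD1 in_arcsD2\<close>)
qed

end

theory Submission
  imports Defs
begin

text \<open>
  Numbering the vertices of \<open>BF(p, q)\<close> by \<open>1, \<dots>, N\<close>, the graph is the path \<open>1 - 2 - \<dots> - N\<close> with the
  two chords \<open>{1, p}\<close> and \<open>{p, N}\<close>, so that a walk inside one copy of it in the OTIS graph is made of
  monotone runs and chords. Hamiltonian cycles of \<open>OTIS(BF(3, 3))\<close> and \<open>OTIS(BF(5, 3))\<close> (found by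
  computer) are extended by lengthening a cycle of the butterfly by pairs of vertices \<open>x, y\<close>, all
  inserted into one edge. Each new copy is covered by paths whose ends lie in a fixed set of copies.
  For each such path, with ends in copies \<open>g\<close> and \<open>h\<close>, say, the cycle is opened in copy \<open>g\<close> at the
  subdivided edge, between \<open>x\<close> and \<open>y\<close>: from \<open>\<langle>g, x\<rangle>\<close> it runs along the path in copy \<open>x\<close>, passes from
  \<open>\<langle>h, x\<rangle>\<close> to \<open>\<langle>h, y\<rangle>\<close> in copy \<open>h\<close> and runs back along the same path in copy \<open>y\<close> to \<open>\<langle>g, y\<rangle>\<close>, next
  to the following pair. The base case \<open>(5, 3)\<close> gives all \<open>m \<ge> 2\<close>, and \<open>(3, 3)\<close> gives \<open>m = 1\<close>.
\<close>

section \<open>Walks as vertex lists\<close>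

fun walk :: "'a pair_pre_digraph \<Rightarrow> 'a \<Rightarrow> 'a list \<Rightarrow> 'a \<Rightarrow> bool" where
  "walk G s [] t \<longleftrightarrow> s = t"
| "walk G s (x # L) t \<longleftrightarrow> (s, x) \<in> parcs G \<and> walk G x L t"

text \<open>The list of a walk omits its start and keeps its end, so joining walks is plain
  \<open>@\<close>.\<close>

lemma walk_append: "walk G s L r \<Longrightarrow> walk G r L' t \<Longrightarrow> walk G s (L @ L') t"
  by (induction L arbitrary: s) auto

lemma walk_concat_upt:
  assumes "\<And>i. i < k \<Longrightarrow> walk G (f i) (B i) (f (Suc i))"
  shows "walk G (f 0) (concat (map B [0..<k])) (f k)"
  using assms by (induction k) (auto intro: walk_append)

lemma walk_concat_rev_upt:
  assumes "\<And>i. i < k \<Longrightarrow> walk G (f (Suc i)) (B i) (f i)"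
  shows "walk G (f k) (concat (map B (rev [0..<k]))) (f 0)"
  using assms by (induction k) (auto intro: walk_append)

lemma walk_last: "walk G s L t \<Longrightarrow> last (s # L) = t"
  by (induction L arbitrary: s) auto

lemma walk_imp_awalk:
  assumes "walk G s L t" "s \<in> pverts G"
  shows "pre_digraph.awalk (with_proj G) s (zip (s # L) L) t"
    and "pre_digraph.awalk_verts (with_proj G) s (zip (s # L) L) = s # L"
proof -
  have "pre_digraph.cas (with_proj G) s (zip (s # L) L) t \<and> set (zip (s # L) L) \<subseteq> parcs G"
    using assms(1) by (induction L arbitrary: s) (auto simp: pre_digraph.cas.simps)
  then show "pre_digraph.awalk (with_proj G) s (zip (s # L) L) t"
    using assms(2) by (simp add: pre_digraph.awalk_def)
  show "pre_digraph.awalk_verts (with_proj G) s (zip (s # L) L) = s # L"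
    by (induction L arbitrary: s) (auto simp: pre_digraph.awalk_verts.simps)
qed

text \<open>A spanning closed walk of length \<open>|V|\<close> repeats no vertex, by counting.\<close>

lemma hamiltonian_if_walk:
  assumes walk: "walk G s L s" and fin: "finite (pverts G)"
    and cover: "pverts G \<subseteq> set L" and len: "length L = card (pverts G)" and "3 \<le> length L"
    and s: "s \<in> pverts G"
  shows "hamiltonian G"
proof -
  have "card (set L) \<le> card (pverts G)"
    using card_length[of L] len by simp
  then have set: "set L = pverts G"
    using card_seteq[OF finite_set cover] by simp
  then have dist: "distinct L"
    using len by (simp add: card_distinct)
  let ?C = "zip (s # L) L"
  have ne: "L \<noteq> []" using assms(5) by auto
  have "fst ` set ?C = set (map fst ?C)" by simp
  also have "map fst ?C = butlast (s # L)"
    by (simp add: map_fst_zip_take butlast_conv_take)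
  also have "set (butlast (s # L)) = set L"
  proof -
    have "s # L = butlast (s # L) @ [s]"
      using walk_last[OF walk] by (metis append_butlast_last_id list.distinct(1))
    then have "insert s (set L) = insert s (set (butlast (s # L)))"
      by (metis list.set(2) list.simps(15) rotate1.simps(2) set_rotate1)
    moreover have "s \<in> set (butlast (s # L))" using ne by simp
    ultimately show ?thesis using set s by auto
  qed
  finally have "fst ` set ?C = pverts G" using set by simp
  moreover have "pre_digraph.cycle (with_proj G) ?C"
    using walk_imp_awalk[OF walk s] dist ne by (auto simp: pre_digraph.cycle_def)
  moreover have "3 \<le> length ?C" using assms(5) by simp
  ultimately show ?thesis unfolding hamiltonian_def by blast
qed

section \<open>Monotone runs and arcs in the OTIS graph of a butterfly\<close>

text \<open>The vertices of a monotone run inside copy \<open>u\<close>, without its starting point \<open>(u, i)\<close>.\<close>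

definition up :: "nat \<Rightarrow> nat \<Rightarrow> nat \<Rightarrow> (nat \<times> nat) list" where
  "up u i j = map (Pair u) [Suc i..<Suc j]"

definition dn :: "nat \<Rightarrow> nat \<Rightarrow> nat \<Rightarrow> (nat \<times> nat) list" where
  "dn u i j = map (Pair u) (rev [j..<i])"

lemma set_up [simp]: "set (up u i j) = {u} \<times> {i<..j}"
  by (auto simp: up_def)

lemma set_dn [simp]: "set (dn u i j) = {u} \<times> {j..<i}"
  by (auto simp: dn_def)

lemma length_up [simp]: "length (up u i j) = j - i"
  by (simp add: up_def del: upt_Suc)

lemma length_dn [simp]: "length (dn u i j) = i - j"
  by (simp add: dn_def)

lemma mem_cycle_edges:
  "(x, y) \<in> cycle_edges a b \<longleftrightarrow>
    a \<le> x \<and> x < b \<and> y = Suc x \<or> a \<le> y \<and> y < b \<and> x = Suc y \<or>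
    x = a \<and> y = b \<or> x = b \<and> y = a"
  by (auto simp: cycle_edges_def)

lemma arc_BF:
  assumes "1 \<le> p" "1 \<le> q"
  shows "(x, y) \<in> parcs (BF p q) \<longleftrightarrow> 1 \<le> x \<and> x < p + q \<and> 1 \<le> y \<and> y < p + q \<and>
    (y = Suc x \<or> x = Suc y \<or> x = 1 \<and> y = p \<or> x = p \<and> y = 1 \<or>
     x = p \<and> y = p + q - 1 \<or> x = p + q - 1 \<and> y = p)"
proof -
  obtain r where q: "q = Suc r" using assms(2) by (cases q) auto
  show ?thesis
    using assms(1) unfolding BF_def q by (cases "x < p"; cases "y < p") (auto simp: mem_cycle_edges)
qed

lemma arc_OTIS_BF:
  assumes "1 \<le> p" "1 \<le> q"
  shows "((u, x), (v, y)) \<in> parcs (OTIS (BF p q)) \<longleftrightarrow>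
    1 \<le> u \<and> u < p + q \<and> 1 \<le> x \<and> x < p + q \<and>
    (u = v \<and> 1 \<le> y \<and> y < p + q \<and>
       (y = Suc x \<or> x = Suc y \<or> x = 1 \<and> y = p \<or> x = p \<and> y = 1 \<or>
        x = p \<and> y = p + q - 1 \<or> x = p + q - 1 \<and> y = p)
     \<or> u \<noteq> v \<and> x = v \<and> y = u)"
proof -
  have "pverts (BF p q) = {x. 1 \<le> x \<and> x < p + q}"
    using assms by (auto simp: BF_def)
  moreover have "((u, x), (v, y)) \<in> parcs (OTIS (BF p q)) \<longleftrightarrow>
    u \<in> pverts (BF p q) \<and> u = v \<and> (x, y) \<in> parcs (BF p q) \<or>
    u \<in> pverts (BF p q) \<and> x \<in> pverts (BF p q) \<and> u \<noteq> x \<and> x = v \<and> y = u"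
    unfolding OTIS_def by auto
  ultimately show ?thesis
    by (cases "u = v") (auto simp: arc_BF[OF assms])
qed

lemma walk_up:
  assumes "1 \<le> p" "1 \<le> q" "1 \<le> u" "u < p + q" "1 \<le> i" "i \<le> j" "j < p + q"
  shows "walk (OTIS (BF p q)) (u, i) (up u i j) (u, j)"
  using assms(6,7)
proof (induction j rule: dec_induct)
  case base
  then show ?case by (simp add: up_def)
next
  case (step j)
  have "up u i (Suc j) = up u i j @ [(u, Suc j)]"
    using step.hyps by (simp add: up_def)
  then show ?case
    using walk_append[OF step.IH, of "[(u, Suc j)]"] step assms(1-5) by (simp add: arc_OTIS_BF)
qed

lemma walk_dn:
  assumes "1 \<le> p" "1 \<le> q" "1 \<le> u" "u < p + q" "1 \<le> j" "j \<le> i" "i < p + q"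
  shows "walk (OTIS (BF p q)) (u, i) (dn u i j) (u, j)"
  using assms(6,7)
proof (induction i rule: dec_induct)
  case base
  then show ?case by (simp add: dn_def)
next
  case (step i)
  have "dn u (Suc i) j = (u, i) # dn u i j"
    using step.hyps by (simp add: dn_def)
  then show ?case
    using step assms(1-5) by (simp add: arc_OTIS_BF)
qed

lemma walk_up_append:
  assumes "walk (OTIS (BF p q)) (u, j) L t"
    and "1 \<le> p" "1 \<le> q" "1 \<le> u" "u < p + q" "1 \<le> i" "i \<le> j" "j < p + q"
  shows "walk (OTIS (BF p q)) (u, i) (up u i j @ L) t"
  using assms by (blast intro: walk_append walk_up)

lemma walk_dn_append:
  assumes "walk (OTIS (BF p q)) (u, j) L t"
    and "1 \<le> p" "1 \<le> q" "1 \<le> u" "u < p + q" "1 \<le> j" "j \<le> i" "i < p + q"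
  shows "walk (OTIS (BF p q)) (u, i) (dn u i j @ L) t"
  using assms by (blast intro: walk_append walk_dn)

lemmas walk_intros = walk_up walk_dn walk_up_append walk_dn_append

lemma pverts_OTIS_BF: "pverts (OTIS (BF p q)) = {1..p + q - 1} \<times> {1..p + q - 1}"
  by (simp add: OTIS_def BF_def)

lemma hamiltonian_OTIS_BF_if_walk:
  assumes "3 \<le> p" "3 \<le> q" "walk (OTIS (BF p q)) s L s"
    and len: "length L = (p + q - 1) * (p + q - 1)"
    and cover: "\<And>a b. a \<in> {1..p + q - 1} \<Longrightarrow> b \<in> {1..p + q - 1} \<Longrightarrow> (a, b) \<in> set L"
    and s: "s \<in> {1..p + q - 1} \<times> {1..p + q - 1}"
  shows "hamiltonian (OTIS (BF p q))"
proof (rule hamiltonian_if_walk[of _ s L])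
  have "3 * 1 \<le> (p + q - 1) * (p + q - 1)"
    using assms(1,2) by (intro mult_le_mono) auto
  then show "3 \<le> length L" using len by simp
qed (use assms in \<open>auto simp: pverts_OTIS_BF\<close>)

lemma subset_row: "{u} \<times> I \<subseteq> S \<longleftrightarrow> (\<forall>x\<in>I. (u, x) \<in> S)"
  by auto

lemmas subset_set_simps = subset_row UN_subset_iff insert_subset Un_subset_iff

section \<open>First cycle a triangle\<close>

lemma BF_3_cases:
  fixes x K :: nat
  assumes "1 \<le> x" "x \<le> 2 * K + 5"
  obtains (1) "x = 1" | (2) "x = 2" | (3) "x = 3"
    | (4) k where "k < K" "x = 4 + 2 * k" | (5) k where "k < K" "x = 5 + 2 * k"
    | (6) "x = 2 * K + 4" | (7) "x = 2 * K + 5"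
proof -
  define k where "k = (x - 4) div 2"
  show thesis
  proof (cases "4 \<le> x \<and> x < 2 * K + 4")
    case True
    then have "k < K" "x = 4 + 2 * k \<or> x = 5 + 2 * k"
      unfolding k_def by presburger+
    then show thesis using that by blast
  next
    case False
    then have "x = 1 \<or> x = 2 \<or> x = 3 \<or> x = 2 * K + 4 \<or> x = 2 * K + 5"
      using assms by presburger
    then show thesis using that by blast
  qed
qed

lemma hamiltonian_OTIS_BF_3:
  "hamiltonian (OTIS (BF 3 (2 * K + 3)))"
proof -
  let ?G = "OTIS (BF 3 (2 * K + 3))"
  define e where "e = 2 * K + 4"
  define N where "N = 2 * K + 5"
  note defs = e_def N_def
  note arc = arc_OTIS_BF[of 3 "2 * K + 3"]
  \<comment> \<open>The pairs lengthen the second cycle between \<open>3\<close> and \<open>e\<close>; the index is the copy in which the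
    cycle is opened.\<close>
  define B1 where "B1 k = (let x = 4 + 2 * k; y = 5 + 2 * k in
    [(1, x), (x, 1), (x, 2), (2, x), (2, y), (y, 2), (y, 1), (1, y)])" for k :: nat
  \<comment> \<open>In copies \<open>x\<close> and \<open>y\<close>, \<open>B1\<close> visits second
    coordinates 1 and 2, and \<open>Be\<close> those from 3 to \<open>N\<close>.\<close>
  define Be where "Be k = (let x = 4 + 2 * k; y = 5 + 2 * k in
    [(e, x), (x, e)] @ dn x e 3 @
    [(x, N), (N, x), (N, y), (y, N), (y, 3)] @ up y 3 e @ [(e, y)])" for k :: nat
  note blocks = B1_def Be_def Let_def
  \<comment> \<open>Block \<open>k\<close> starts at 3 + 2k: this is \<open>y\<close> of the
    previous pair, or vertex 3 if k = 0.\<close>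
  have B1: "walk ?G (1, 3 + 2 * 0) (concat (map B1 [0..<K])) (1, 3 + 2 * K)"
    by (rule walk_concat_upt[where f = "\<lambda>k. (1, 3 + 2 * k)"]) (auto simp: blocks arc)
  have Be: "walk ?G (e, 3 + 2 * 0) (concat (map Be [0..<K])) (e, 3 + 2 * K)"
    by (rule walk_concat_upt[where f = "\<lambda>k. (e, 3 + 2 * k)"])
      (auto simp: blocks defs arc intro!: walk_intros)
  \<comment> \<open>For \<open>K = 0\<close> this is the base cycle of \<open>OTIS (BF 3 3)\<close>;
    the blocks subdivide its edges from \<open>(1, 3)\<close> to \<open>(1, e)\<close> and from
    \<open>(e, 3)\<close> to \<open>(e, e)\<close>.\<close>
  define L where "L =
    [(3, 1), (3, 2), (2, 3), (2, 2), (2, 1), (1, 2), (1, 1), (1, 3)] @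
    concat (map B1 [0..<K]) @
    [(1, e), (1, N), (N, 1), (N, 2), (2, N), (2, e), (e, 2), (e, 1), (e, 3)] @
    concat (map Be [0..<K]) @
    [(e, e), (e, N), (N, e), (N, N), (N, 3), (3, N)] @ dn 3 N 3"
  show ?thesis
  proof (rule hamiltonian_OTIS_BF_if_walk[where s = "(3, 3)" and L = L])
    have "walk ?G (3, 3) [(3, 1), (3, 2), (2, 3), (2, 2), (2, 1), (1, 2), (1, 1), (1, 3)]
        (1, 3 + 2 * 0)"
      by (auto simp: arc)
    moreover note B1
    moreover have "walk ?G (1, 3 + 2 * K)
        [(1, e), (1, N), (N, 1), (N, 2), (2, N), (2, e), (e, 2), (e, 1), (e, 3)] (e, 3 + 2 * 0)"
      by (auto simp: arc defs)
    moreover note Be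
    moreover have "walk ?G (e, 3 + 2 * K)
        ([(e, e), (e, N), (N, e), (N, N), (N, 3), (3, N)] @ dn 3 N 3) (3, 3)"
      by (auto simp: arc defs intro!: walk_intros)
    ultimately show "walk ?G (3, 3) L (3, 3)"
      unfolding L_def by - (assumption | rule walk_append)+
    show "length L = (3 + (2 * K + 3) - 1) * (3 + (2 * K + 3) - 1)"
      by (simp add: L_def length_concat comp_def blocks defs sum_list_triv algebra_simps)
  next
    fix a b assume "a \<in> {1..3 + (2 * K + 3) - 1}" "b \<in> {1..3 + (2 * K + 3) - 1}"
    then have ab: "1 \<le> a" "a \<le> 2 * K + 5" "1 \<le> b" "b \<le> 2 * K + 5" by auto
    \<comment> \<open>Unfolding \<open>L\<close> only on the left of \<open>set L \<subseteq> S\<close> turns it into membership rewrite rules.\<close>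
    define S where "S = set L"
    have "set L \<subseteq> S" by (simp add: S_def)
    note mem = this[unfolded L_def blocks defs, simplified, unfolded subset_set_simps]
    have "(a, b) \<in> S"
      by (rule BF_3_cases[OF ab(1,2)]; rule BF_3_cases[OF ab(3,4)]; simp add: mem)
    then show "(a, b) \<in> set L" by (simp add: S_def)
  qed (auto simp: L_def N_def)
qed

section \<open>First cycle of length at least 5\<close>

lemma BF_5_cases:
  fixes x M K :: nat
  assumes "1 \<le> x" "x \<le> 2 * M + 2 * K + 7"
  obtains (1) "x = 1" | (2) "x = 2" | (3) "x = 3"
    | (4) k where "k < M" "x = 4 + 2 * k" | (5) k where "k < M" "x = 5 + 2 * k"
    | (6) "x = 2 * M + 4" | (7) "x = 2 * M + 5"
    | (8) k where "k < K" "x = 2 * M + 2 * k + 6" | (9) k where "k < K" "x = 2 * M + 2 * k + 7"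
    | (10) "x = 2 * M + 2 * K + 6" | (11) "x = 2 * M + 2 * K + 7"
proof (cases "x \<le> 2 * M + 5")
  case True
  with assms(1) show thesis by (cases x rule: BF_3_cases) (use that in auto)
next
  case False
  \<comment> \<open>The shift moves the vertices beyond 2M + 5 to 4, ..., 2K + 5, to reuse the
    previous classification.\<close>
  then have "1 \<le> x - (2 * M + 2)" "x - (2 * M + 2) \<le> 2 * K + 5"
    using assms(2) by auto
  then show thesis
  proof (cases "x - (2 * M + 2)" rule: BF_3_cases)
    case (4 k)
    then show thesis using False by (intro that(8)[of k]) auto
  next
    case (5 k)
    then show thesis using False by (intro that(9)[of k]) auto
  qed (use False that(10,11) in auto)
qed

lemma hamiltonian_OTIS_BF_5:
  "hamiltonian (OTIS (BF (2 * M + 5) (2 * K + 3)))"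
proof -
  let ?G = "OTIS (BF (2 * M + 5) (2 * K + 3))"
  define d where "d = 2 * M + 4"
  define c where "c = 2 * M + 5"
  define e where "e = 2 * M + 2 * K + 6"
  define N where "N = 2 * M + 2 * K + 7"
  note defs = d_def c_def e_def N_def
  note arc = arc_OTIS_BF[of "2 * M + 5" "2 * K + 3"]
  \<comment> \<open>Pairs with \<open>A\<close> lengthen the first cycle between \<open>3\<close> and \<open>d\<close>, pairs with \<open>B\<close> the second one
    between \<open>c\<close> and \<open>e\<close>; the index is the copy in which the cycle is opened.\<close>
  define Ad where "Ad k = (let x = 4 + 2 * k; y = 5 + 2 * k in
    [(d, x), (x, d)] @ dn x d 1 @ [(1, x), (1, y), (y, 1)] @ up y 1 d @ [(d, y)])" for k
  \<comment> \<open>\<open>Ad\<close> visits second coordinates 1 to \<open>d\<close> of copies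
    \<open>x\<close> and \<open>y\<close>, \<open>AN\<close> those from \<open>c\<close> to
    \<open>N\<close>.\<close>
  define AN where "AN k = (let x = 4 + 2 * k; y = 5 + 2 * k in
    [(N, y), (y, N), (y, c)] @ up y c e @ [(e, y), (e, x), (x, e)] @ dn x e c @
    [(x, N), (N, x)])" for k
  \<comment> \<open>Here the split is \<open>c\<close> to \<open>N\<close> for \<open>Bc\<close>, 1
    and 2 for \<open>B2\<close>, 3 to \<open>d\<close> for \<open>B3\<close>.\<close>
  define Bc where "Bc k = (let x = 2 * M + 2 * k + 6; y = 2 * M + 2 * k + 7 in
    [(c, x), (x, c)] @ up x c N @ [(N, x), (N, y), (y, N)] @ dn y N c @ [(c, y)])" for k
  define B2 where "B2 k = (let x = 2 * M + 2 * k + 6; y = 2 * M + 2 * k + 7 in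
    [(2, y), (y, 2), (y, 1), (1, y), (1, x), (x, 1), (x, 2), (2, x)])" for k
  define B3 where "B3 k = (let x = 2 * M + 2 * k + 6; y = 2 * M + 2 * k + 7 in
    [(3, x), (x, 3)] @ up x 3 d @ [(d, x), (d, y), (y, d)] @ dn y d 3 @ [(3, y)])" for k
  note blocks = Ad_def AN_def Bc_def B2_def B3_def Let_def
  have Ad: "walk ?G (d, 3 + 2 * 0) (concat (map Ad [0..<M])) (d, 3 + 2 * M)"
    by (rule walk_concat_upt[where f = "\<lambda>k. (d, 3 + 2 * k)"])
      (auto simp: blocks defs arc intro!: walk_intros)
  \<comment> \<open>In copies \<open>N\<close> and 2 the subdivided edge is crossed downwards, so
    the pairs come in decreasing order.\<close>
  have AN: "walk ?G (N, 4 + 2 * M) (concat (map AN (rev [0..<M]))) (N, 4 + 2 * 0)"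
    by (rule walk_concat_rev_upt[where f = "\<lambda>k. (N, 4 + 2 * k)"])
      (auto simp: blocks defs arc intro!: walk_intros)
  have Bc: "walk ?G (c, 2 * M + 5 + 2 * 0) (concat (map Bc [0..<K])) (c, 2 * M + 5 + 2 * K)"
    by (rule walk_concat_upt[where f = "\<lambda>k. (c, 2 * M + 5 + 2 * k)"])
      (auto simp: blocks defs arc intro!: walk_intros)
  have B2: "walk ?G (2, 2 * M + 6 + 2 * K) (concat (map B2 (rev [0..<K]))) (2, 2 * M + 6 + 2 * 0)"
    by (rule walk_concat_rev_upt[where f = "\<lambda>k. (2, 2 * M + 6 + 2 * k)"])
      (auto simp: blocks defs arc intro!: walk_intros)
  have B3: "walk ?G (3, 2 * M + 5 + 2 * 0) (concat (map B3 [0..<K])) (3, 2 * M + 5 + 2 * K)"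
    by (rule walk_concat_upt[where f = "\<lambda>k. (3, 2 * M + 5 + 2 * k)"])
      (auto simp: blocks defs arc intro!: walk_intros)
  \<comment> \<open>For \<open>M = K = 0\<close> the parts \<open>L1\<close> to \<open>L5\<close>
    form the base cycle of \<open>OTIS (BF 5 3)\<close>, cut at the five edges to be
    subdivided.\<close>
  define L1 where "L1 = [(c, e), (c, N), (N, c), (N, N), (N, e), (e, N)] @ dn e N d @
    [(d, e), (d, N), (N, d)]"
  define L2 where "L2 = [(N, 3), (3, N), (3, c)]"
  define L3 where "L3 = [(3, e), (e, 3), (e, 2), (e, 1), (1, e), (1, N), (N, 1), (N, 2), (2, N),
    (2, e)]"
  define L4 where "L4 = [(2, c), (2, 1)] @ up 2 1 d @
    [(d, 2), (d, 1), (1, d), (1, c), (1, 1), (1, 2), (1, 3), (3, 1), (3, 2), (3, 3)] @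
    up 3 3 d @ [(d, 3)]"
  define L5 where "L5 = [(d, d), (d, c), (c, d)] @ dn c d 1 @ [(c, c)]"
  note parts = L1_def L2_def L3_def L4_def L5_def
  define L where "L =
    concat (map Bc [0..<K]) @ L1 @ concat (map AN (rev [0..<M])) @ L2 @
    concat (map B3 [0..<K]) @ L3 @ concat (map B2 (rev [0..<K])) @ L4 @
    concat (map Ad [0..<M]) @ L5"
  show ?thesis
  proof (rule hamiltonian_OTIS_BF_if_walk[where s = "(c, 2 * M + 5 + 2 * 0)" and L = L])
    have "walk ?G (c, 2 * M + 5 + 2 * K) L1 (N, 4 + 2 * M)"
      by (auto simp: parts arc defs intro!: walk_intros)
    moreover have "walk ?G (N, 4 + 2 * 0) L2 (3, 2 * M + 5 + 2 * 0)"
      by (auto simp: parts arc defs)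
    moreover have "walk ?G (3, 2 * M + 5 + 2 * K) L3 (2, 2 * M + 6 + 2 * K)"
      by (auto simp: parts arc defs)
    moreover have "walk ?G (2, 2 * M + 6 + 2 * 0) L4 (d, 3 + 2 * 0)"
      by (auto simp: parts arc defs intro!: walk_intros)
    moreover have "walk ?G (d, 3 + 2 * M) L5 (c, 2 * M + 5 + 2 * 0)"
      by (auto simp: parts arc defs intro!: walk_intros)
    moreover note Ad AN Bc B2 B3
    ultimately show "walk ?G (c, 2 * M + 5 + 2 * 0) L (c, 2 * M + 5 + 2 * 0)"
      unfolding L_def by - (assumption | rule walk_append)+
    show "length L = (2 * M + 5 + (2 * K + 3) - 1) * (2 * M + 5 + (2 * K + 3) - 1)"
      by (simp add: L_def parts length_concat comp_def blocks defs sum_list_triv algebra_simps)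
  next
    fix a b
    assume "a \<in> {1..2 * M + 5 + (2 * K + 3) - 1}" "b \<in> {1..2 * M + 5 + (2 * K + 3) - 1}"
    then have ab: "1 \<le> a" "a \<le> 2 * M + 2 * K + 7" "1 \<le> b" "b \<le> 2 * M + 2 * K + 7" by auto
    define S where "S = set L"
    have "set L \<subseteq> S" by (simp add: S_def)
    note mem = this[unfolded L_def parts blocks defs, simplified, unfolded subset_set_simps]
    have "(a, b) \<in> S"
      by (rule BF_5_cases[OF ab(1,2)]; rule BF_5_cases[OF ab(3,4)]; simp add: mem)
    then show "(a, b) \<in> set L" by (simp add: S_def)
  qed (auto simp: L_def parts defs)
qed

theorem mainTheorem1:
  fixes m n :: nat
  assumes "m \<ge> 1" and "n \<ge> 1"
  shows "hamiltonian (OTIS (BF (2 * m + 1) (2 * n + 1)))"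
proof -
  from assms(2) obtain K where n: "2 * n + 1 = 2 * K + 3"
    by (intro that[of "n - 1"]) simp
  show ?thesis
  proof (cases "m = 1")
    case True
    then show ?thesis using hamiltonian_OTIS_BF_3[of K] unfolding n by simp
  next
    case False
    with assms(1) obtain M where m: "2 * m + 1 = 2 * M + 5"
      by (intro that[of "m - 2"]) simp
    show ?thesis unfolding m n by (rule hamiltonian_OTIS_BF_5)
  qed
qed

end
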